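(* Let $\beta>0$, $\alpha>1$, $\mathbf{t}=(t_1,t_2)\in\mathbb{R}^2$, $|\mathbf{t}|=\sqrt{t_1^2+t_2^2}$, and let $Z$ be the moving maximum process on $\mathbb{R}^2$ generated by the bivariate $t$-density $$\phi(u_1,u_2)=\frac{\beta^2}{2\pi}\left\{1+\frac{\beta^2(u_1^2+u_2^2)}{2(\alpha-1)}\right\}^{-\alpha}.$$ Let $(T_1,T_2)$ be a random vector with density $\phi$. Put $$b_{1,\alpha}=1+\frac{\beta^2|\mathbf{t}|^2}{4(\alpha-1)}-\frac{\beta|\mathbf{t}|}{\sqrt{2(\alpha-1)}}\sqrt{1+\frac{\beta^2|\mathbf{t}|^2}{8(\alpha-1)}},\qquad b_{2,\alpha}=1+\frac{\beta^2|\mathbf{t}|^2}{4(\alpha-1)}+\frac{\beta|\mathbf{t}|}{\sqrt{2(\alpha-1)}}\sqrt{1+\frac{\beta^2|\mathbf{t}|^2}{8(\alpha-1)}}.$$ For $w_1,w_2>0$ let $x=(w_1/w_2)^{1/\alpha}$ and, when $x\ne1$, $$A_{1,\alpha}=\left\{(u_1,u_2)\in\mathbb{R}^2:\left(u_1-\frac{t_1}{1-x}\right)^2+\left(u_2-\frac{t_2}{1-x}\right)^2\le\frac{x|\mathbf{t}|^2}{(1-x)^2}-\frac{2(\alpha-1)}{\beta^2}\right\},$$ $$A_{2,\alpha}=\left\{(u_1,u_2)\in\mathbb{R}^2:\left(u_1-\frac{t_1x}{1-x}\right)^2+\left(u_2-\frac{t_2x}{1-x}\right)^2\le\frac{x|\mathbf{t}|^2}{(1-x)^2}-\frac{2(\alpha-1)}{\beta^2}\right\}.$$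 Then for all $w_1,w_2>0$, $$-\log P\{Z(0,0)\le w_1,Z(t_1,t_2)\le w_2\}=\begin{cases}\dfrac1{w_2}, & 0<w_2<b_{2,\alpha}^{-\alpha}w_1,\\[2mm] \dfrac1{w_1}P\{(T_1,T_2)\in A_{1,\alpha}\}+\dfrac1{w_2}P\{(T_1,T_2)\in A_{2,\alpha}^c\}, & b_{2,\alpha}^{-\alpha}w_1\le w_2<w_1,\\[2mm] \dfrac2wP\{T_1\le|\mathbf{t}|/2\}, & w_1=w_2=:w,\\[2mm] \dfrac1{w_1}P\{(T_1,T_2)\in A_{1,\alpha}^c\}+\dfrac1{w_2}P\{(T_1,T_2)\in A_{2,\alpha}\}, & w_1<w_2<b_{1,\alpha}^{-\alpha}w_1,\\[2mm] \dfrac1{w_1}, & w_2\ge b_{1,\alpha}^{-\alpha}w_1.\end{cases}$$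
   Context: For a unimodal (nonincreasing in each direction starting from the mode) continuous probability density $\phi$ on $\mathbb{R}^2$, let $\{(X_j,W_j,Y_j)\}_{j\ge1}$ be the points of a homogeneous (unit intensity) Poisson process on $\mathbb{R}^2\times\mathbb{R}_+$. The moving maximum process on $\mathbb{R}^2$ generated by $\phi$ is $$Z(t_1,t_2):=\max_{j\ge1}\frac{\phi(X_j-t_1,W_j-t_2)}{Y_j},\qquad (t_1,t_2)\in\mathbb{R}^2.$$ It is stationary and simple max-stable, and for $\mathbf{t}_i\in\mathbb{R}^2$, $x_i>0$, $$P\{Z(\mathbf{t}_1)\le x_1,\dots,Z(\mathbf{t}_d)\le x_d\}=\exp\left\{-\int_{\mathbb{R}^2}\max_{1\le i\le d}\frac{\phi(\mathbf{s}-\mathbf{t}_i)}{x_i}\,d\mathbf{s}\right\}.$$ $A^c$ denotes the complement of $A$ in $\mathbb{R}^2$. *)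

theory Defs
  imports "HOL-Probability.Probability"
begin

text \<open>
  Points are enumerated by \<^typ>\<open>nat\<close>, so this describes Poisson processes whose intensity measure
  has infinite total mass. The number of points in a set is counted with multiplicity, in
  \<^typ>\<open>ennreal\<close>, so that sets containing infinitely many points are counted correctly.
\<close>

definition num_points :: "(nat \<Rightarrow> 'a \<Rightarrow> 'b) \<Rightarrow> 'b set \<Rightarrow> 'a \<Rightarrow> ennreal" where
  "num_points P B \<omega> = emeasure (count_space UNIV) {j. P j \<omega> \<in> B}"

text \<open>
  The Poisson probabilities are written out instead of using \<^const>\<open>poisson_pmf\<close>, since the
  latter requires a positive rate and null sets must be covered as well.
\<close>

definition poisson_process :: "'a measure \<Rightarrow> 'b measure \<Rightarrow> (nat \<Rightarrow> 'a \<Rightarrow> 'b) \<Rightarrow> bool" where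
  "poisson_process M \<mu> P \<longleftrightarrow>
     prob_space M \<and>
     (\<forall>j. P j \<in> measurable M \<mu>) \<and>
     (\<forall>B\<in>sets \<mu>. emeasure \<mu> B < \<infinity> \<longrightarrow>
        (\<forall>k::nat. measure M {\<omega> \<in> space M. num_points P B \<omega> = of_nat k} =
           measure \<mu> B ^ k / fact k * exp (- measure \<mu> B))) \<and>
     (\<forall>B\<in>sets \<mu>. emeasure \<mu> B = \<infinity> \<longrightarrow> (AE \<omega> in M. num_points P B \<omega> = \<infinity>)) \<and>
     (\<forall>(n::nat) B. (\<forall>i<n. B i \<in> sets \<mu>) \<and> disjoint_family_on B {..<n} \<longrightarrow>
        prob_space.indep_vars M (\<lambda>_. borel) (\<lambda>i. num_points P (B i)) {..<n})"

definition unit_intensity :: "((real \<times> real) \<times> real) measure" where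
  "unit_intensity = restrict_space lborel (UNIV \<times> {0..})"

text \<open>
  The maximum over the points is rendered as a supremum in \<^typ>\<open>ereal\<close>; a division by
  \<^term>\<open>0::ereal\<close> of a positive number there yields \<^term>\<open>\<infinity>::ereal\<close>.
\<close>

definition moving_max ::
  "(real \<times> real \<Rightarrow> real) \<Rightarrow> (nat \<Rightarrow> 'a \<Rightarrow> real) \<Rightarrow> (nat \<Rightarrow> 'a \<Rightarrow> real) \<Rightarrow> (nat \<Rightarrow> 'a \<Rightarrow> real) \<Rightarrow>
    real \<times> real \<Rightarrow> 'a \<Rightarrow> ereal" where
  "moving_max \<phi> X W Y = (\<lambda>(t1, t2) \<omega>.
     SUP j. ereal (\<phi> (X j \<omega> - t1, W j \<omega> - t2)) / ereal (Y j \<omega>))"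

definition t_density :: "real \<Rightarrow> real \<Rightarrow> real \<times> real \<Rightarrow> real" where
  "t_density \<beta> \<alpha> = (\<lambda>(u1, u2).
     \<beta>\<^sup>2 / (2 * pi) * (1 + \<beta>\<^sup>2 * (u1\<^sup>2 + u2\<^sup>2) / (2 * (\<alpha> - 1))) powr (- \<alpha>))"

definition b1 :: "real \<Rightarrow> real \<Rightarrow> real \<times> real \<Rightarrow> real" where
  "b1 \<beta> \<alpha> t = 1 + \<beta>\<^sup>2 * (norm t)\<^sup>2 / (4 * (\<alpha> - 1))
     - \<beta> * norm t / sqrt (2 * (\<alpha> - 1)) * sqrt (1 + \<beta>\<^sup>2 * (norm t)\<^sup>2 / (8 * (\<alpha> - 1)))"

definition b2 :: "real \<Rightarrow> real \<Rightarrow> real \<times> real \<Rightarrow> real" where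
  "b2 \<beta> \<alpha> t = 1 + \<beta>\<^sup>2 * (norm t)\<^sup>2 / (4 * (\<alpha> - 1))
     + \<beta> * norm t / sqrt (2 * (\<alpha> - 1)) * sqrt (1 + \<beta>\<^sup>2 * (norm t)\<^sup>2 / (8 * (\<alpha> - 1)))"

text \<open>The sets below are meaningful only for \<open>x \<noteq> 1\<close>.\<close>

definition A1 :: "real \<Rightarrow> real \<Rightarrow> real \<times> real \<Rightarrow> real \<Rightarrow> (real \<times> real) set" where
  "A1 \<beta> \<alpha> t x = {(u1, u2).
     (u1 - fst t / (1 - x))\<^sup>2 + (u2 - snd t / (1 - x))\<^sup>2
       \<le> x * (norm t)\<^sup>2 / (1 - x)\<^sup>2 - 2 * (\<alpha> - 1) / \<beta>\<^sup>2}"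

definition A2 :: "real \<Rightarrow> real \<Rightarrow> real \<times> real \<Rightarrow> real \<Rightarrow> (real \<times> real) set" where
  "A2 \<beta> \<alpha> t x = {(u1, u2).
     (u1 - fst t * x / (1 - x))\<^sup>2 + (u2 - snd t * x / (1 - x))\<^sup>2
       \<le> x * (norm t)\<^sup>2 / (1 - x)\<^sup>2 - 2 * (\<alpha> - 1) / \<beta>\<^sup>2}"

end

theory Submission
  imports Defs
begin

text \<open>
  The event \<open>Z(0) \<le> w\<^sub>1, Z(t) \<le> w\<^sub>2\<close> says that no point of the Poisson process lies below the graph
  of \<open>max (\<phi>(s) / w\<^sub>1) (\<phi>(s - t) / w\<^sub>2)\<close>, so \<open>L\<close> is the integral of this function. Splitting the
  plane according to which of the two terms is larger turns the integral into probabilities of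
  \<open>(T\<^sub>1, T\<^sub>2)\<close>. With \<open>c = \<beta>\<^sup>2 / (2(\<alpha> - 1))\<close> the first term dominates iff
  \<open>1 + c|s - t|\<^sup>2 \<ge> x (1 + c|s|\<^sup>2)\<close>. For \<open>x \<noteq> 1\<close> completing the square identifies this region with the
  disc \<open>A\<^sub>1\<close> or its complement, and \<open>b\<^sub>1\<close>, \<open>b\<^sub>2\<close> are the values of \<open>x\<close> where the squared radius
  vanishes. For \<open>x = 1\<close> the region is a half-plane, and rotation invariance reduces its probability
  to the distribution of \<open>T\<^sub>1\<close>.
\<close>

section \<open>Invariance of planar Lebesgue measure under translations, shears and
  rotations\<close>

lemma nn_integral_lborel_translate:
  fixes f :: "'a::euclidean_space \<Rightarrow> ennreal"
  assumes [measurable]: "f \<in> borel_measurable borel"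
  shows "(\<integral>\<^sup>+s. f (s + t) \<partial>lborel) = (\<integral>\<^sup>+s. f s \<partial>lborel)"
proof -
  have "(\<integral>\<^sup>+s. f s \<partial>lborel) = (\<integral>\<^sup>+s. f s \<partial>distr lborel borel ((+) t))"
    by (simp add: lborel_distr_plus)
  also have "\<dots> = (\<integral>\<^sup>+s. f (s + t) \<partial>lborel)"
    by (subst nn_integral_distr) (simp_all add: add.commute)
  finally show ?thesis by simp
qed

text \<open>By Tonelli the first coordinate can be integrated first; with \<open>snd s\<close>
  fixed, the shear is a translation by \<open>k * snd s\<close> on the line.\<close>

lemma nn_integral_lborel_shear_fst:
  fixes f :: "real \<times> real \<Rightarrow> ennreal"
  assumes f: "f \<in> borel_measurable borel"
  shows "(\<integral>\<^sup>+s. f (fst s + k * snd s, snd s) \<partial>lborel) = (\<integral>\<^sup>+s. f s \<partial>lborel)"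
proof -
  have [measurable]: "f \<in> borel_measurable (borel \<Otimes>\<^sub>M borel)"
    using f by (simp add: borel_prod)
  have 1: "(\<integral>\<^sup>+s. f (fst s + k * snd s, snd s) \<partial>lborel) =
    (\<integral>\<^sup>+y. \<integral>\<^sup>+x. f (x + k * y, y) \<partial>lborel \<partial>lborel)"
    by (subst lborel_prod[symmetric], subst lborel_pair.nn_integral_snd[symmetric])
       simp_all
  have 2: "(\<integral>\<^sup>+s. f s \<partial>lborel) = (\<integral>\<^sup>+y. \<integral>\<^sup>+x. f (x, y) \<partial>lborel \<partial>lborel)"
    by (subst lborel_prod[symmetric], subst lborel_pair.nn_integral_snd[symmetric])
       simp_all
  have "(\<integral>\<^sup>+x. f (x + k * y, y) \<partial>lborel) = (\<integral>\<^sup>+x. f (x, y) \<partial>lborel)" for y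
    by (rule nn_integral_lborel_translate[where f = "\<lambda>x. f (x, y)"]) measurable
  with 1 2 show ?thesis by simp
qed

lemma nn_integral_lborel_shear_snd:
  fixes f :: "real \<times> real \<Rightarrow> ennreal"
  assumes f: "f \<in> borel_measurable borel"
  shows "(\<integral>\<^sup>+s. f (fst s, snd s + k * fst s) \<partial>lborel) = (\<integral>\<^sup>+s. f s \<partial>lborel)"
proof -
  have [measurable]: "f \<in> borel_measurable (borel \<Otimes>\<^sub>M borel)"
    using f by (simp add: borel_prod)
  have 1: "(\<integral>\<^sup>+s. f (fst s, snd s + k * fst s) \<partial>lborel) =
    (\<integral>\<^sup>+x. \<integral>\<^sup>+y. f (x, y + k * x) \<partial>lborel \<partial>lborel)"
    by (subst lborel_prod[symmetric], subst lborel.nn_integral_fst[symmetric])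
       simp_all
  have 2: "(\<integral>\<^sup>+s. f s \<partial>lborel) = (\<integral>\<^sup>+x. \<integral>\<^sup>+y. f (x, y) \<partial>lborel \<partial>lborel)"
    by (subst lborel_prod[symmetric], subst lborel.nn_integral_fst[symmetric])
       simp_all
  have "(\<integral>\<^sup>+y. f (x, y + k * x) \<partial>lborel) = (\<integral>\<^sup>+y. f (x, y) \<partial>lborel)" for x
    by (rule nn_integral_lborel_translate[where f = "\<lambda>y. f (x, y)"]) measurable
  with 1 2 show ?thesis by simp
qed

text \<open>Rotations inherit area preservation from shears, so no determinant enters. This is what
  later replaces a projection of the random vector in any direction by its first coordinate.\<close>

lemma nn_integral_lborel_rotate:
  fixes f :: "real \<times> real \<Rightarrow> ennreal" and a b :: real
  assumes [measurable]: "f \<in> borel_measurable borel" and ab: "a\<^sup>2 + b\<^sup>2 = 1"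
  shows "(\<integral>\<^sup>+s. f (a * fst s - b * snd s, b * fst s + a * snd s) \<partial>lborel) = (\<integral>\<^sup>+s. f s \<partial>lborel)"
proof -
  \<comment> \<open>The claim is stated for arbitrary \<open>f\<close>, \<open>a\<close>,
    \<open>b\<close> because the half turn applies it twice, the second time to \<open>f\<close>
    composed with a quarter turn.\<close>
  have *: "(\<integral>\<^sup>+s. f (a * fst s - b * snd s, b * fst s + a * snd s) \<partial>lborel) = (\<integral>\<^sup>+s. f s \<partial>lborel)"
    if [measurable]: "f \<in> borel_measurable borel" and ab: "a\<^sup>2 + b\<^sup>2 = 1" and "a \<noteq> -1"
    for f :: "real \<times> real \<Rightarrow> ennreal" and a b :: real
  proof -
    \<comment> \<open>a rotation by \<open>\<theta>\<close> is a product of three shears, with \<open>k = - tan (\<theta> / 2)\<close>\<close>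
    define k where "k = - b / (1 + a)"
    have "1 + a \<noteq> 0" using \<open>a \<noteq> -1\<close> by linarith
    \<comment> \<open>The half-angle identity b / (1 + a) = (1 - a) / b without the division by
      \<open>b\<close>, which may be 0.\<close>
    have "(1 + a) * (1 - a) = b * b"
      using ab by (simp add: algebra_simps power2_eq_square)
    then have kb: "k * b = a - 1"
      using \<open>1 + a \<noteq> 0\<close> by (simp add: k_def field_simps)
    have ka: "k * a = - b - k"
      using \<open>1 + a \<noteq> 0\<close> by (simp add: k_def field_simps)
    define g where "g = (\<lambda>s. f (fst s + k * snd s, snd s))"
    define h where "h = (\<lambda>s. g (fst s, snd s + b * fst s))"
    have f': "f \<in> borel_measurable (borel \<Otimes>\<^sub>M borel)"
      by (simp add: borel_prod)
    have "g \<in> borel_measurable (borel \<Otimes>\<^sub>M borel)"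
      unfolding g_def by (rule measurable_compose[OF _ f']) measurable
    then have "h \<in> borel_measurable (borel \<Otimes>\<^sub>M borel)"
      unfolding h_def by (rule measurable_compose[rotated]) measurable
    with \<open>g \<in> _\<close> have [measurable]: "g \<in> borel_measurable borel" "h \<in> borel_measurable borel"
      by (simp_all add: borel_prod)
    have "h (fst s + k * snd s, snd s) = f (a * fst s - b * snd s, b * fst s + a * snd s)" for s
    proof -
      have "fst s + k * snd s + k * (snd s + b * (fst s + k * snd s))
          = fst s + k * snd s + k * snd s + (k * b) * (fst s + k * snd s)"
        by (simp add: algebra_simps)
      also have "\<dots> = a * fst s + (k + k * a) * snd s"
        unfolding kb by (simp add: algebra_simps)
      also have "\<dots> = a * fst s - b * snd s"
        unfolding ka by simp
      finally have 1: "fst s + k * snd s + k * (snd s + b * (fst s + k * snd s)) = a * fst s - b * snd s" .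
      have "snd s + b * (fst s + k * snd s) = b * fst s + (1 + k * b) * snd s"
        by (simp add: algebra_simps)
      also have "\<dots> = b * fst s + a * snd s" unfolding kb by simp
      finally show ?thesis using 1 by (simp add: h_def g_def)
    qed
    then have "(\<integral>\<^sup>+s. f (a * fst s - b * snd s, b * fst s + a * snd s) \<partial>lborel) = (\<integral>\<^sup>+s. h s \<partial>lborel)"
      using nn_integral_lborel_shear_fst[of h k] by simp
    also have "\<dots> = (\<integral>\<^sup>+s. g s \<partial>lborel)"
      unfolding h_def by (rule nn_integral_lborel_shear_snd) simp
    also have "\<dots> = (\<integral>\<^sup>+s. f s \<partial>lborel)"
      unfolding g_def by (rule nn_integral_lborel_shear_fst) simp
    finally show ?thesis .
  qed
  show ?thesis
  proof (cases "a = -1")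
    case True
    then have "b = 0" using ab by simp
    have "f \<in> borel_measurable (borel \<Otimes>\<^sub>M borel)"
      by (simp add: borel_prod)
    then have "(\<lambda>s. f (- snd s, fst s)) \<in> borel_measurable (borel \<Otimes>\<^sub>M borel)"
      by (rule measurable_compose[rotated]) measurable
    then have meas: "(\<lambda>s. f (- snd s, fst s)) \<in> borel_measurable borel"
      by (simp add: borel_prod)
    \<comment> \<open>the half turn is the square of a quarter turn\<close>
    show ?thesis
      using True \<open>b = 0\<close> *[of f 0 1] *[OF meas, of 0 1] by simp
  qed (use * ab in simp)
qed

section \<open>Void probabilities and the event that the process stays below given levels\<close>

lemma void_probability:
  assumes "poisson_process M \<mu> P" and "B \<in> sets \<mu>" and "emeasure \<mu> B < \<infinity>"
  shows "measure M {\<omega> \<in> space M. \<forall>j. P j \<omega> \<notin> B} = exp (- measure \<mu> B)"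
proof -
  have "measure M {\<omega> \<in> space M. num_points P B \<omega> = of_nat 0} =
      measure \<mu> B ^ 0 / fact 0 * exp (- measure \<mu> B)"
    using assms unfolding poisson_process_def by blast
  moreover have "num_points P B \<omega> = of_nat 0 \<longleftrightarrow> (\<forall>j. P j \<omega> \<notin> B)" for \<omega>
    by (simp add: num_points_def emeasure_count_space_eq_0)
  ultimately show ?thesis by simp
qed

lemma sets_hypograph:
  fixes F :: "'a::second_countable_topology \<Rightarrow> real"
  assumes F: "F \<in> borel_measurable borel"
  shows "{(s, y). 0 \<le> y \<and> y < F s} \<in> sets borel"
proof -
  have "{p \<in> space (borel \<Otimes>\<^sub>M borel). 0 \<le> snd p \<and> snd p < F (fst p)} \<in> sets (borel \<Otimes>\<^sub>M borel)"
    using F by measurable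
  moreover have "{(s, y). 0 \<le> y \<and> y < F s} = {p. 0 \<le> snd p \<and> snd p < F (fst p)}"
    by auto
  ultimately show ?thesis unfolding borel_prod by simp
qed

lemma sets_unit_intensity_hypograph:
  assumes "F \<in> borel_measurable borel"
  shows "{(s, y). 0 \<le> y \<and> y < F s} \<in> sets unit_intensity"
proof -
  have "closed (UNIV \<times> {0..} :: ((real \<times> real) \<times> real) set)"
    by (intro closed_Times) auto
  then show ?thesis
    unfolding unit_intensity_def
    using sets_hypograph[OF assms] by (subst sets_restrict_space_iff) auto
qed

text \<open>The vertical section over \<open>s\<close> is an interval of length \<open>F s\<close>,
  and the hypograph lies in the half-space to which Lebesgue measure was restricted.\<close>

lemma emeasure_unit_intensity_hypograph:
  assumes "F \<in> borel_measurable borel" and F: "\<And>s. 0 \<le> F s"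
  shows "emeasure unit_intensity {(s, y). 0 \<le> y \<and> y < F s} = (\<integral>\<^sup>+s. ennreal (F s) \<partial>lborel)"
proof -
  let ?B = "{(s, y). 0 \<le> y \<and> y < F s}"
  have B: "?B \<in> sets (lborel \<Otimes>\<^sub>M lborel)"
    using sets_hypograph[OF assms(1)] unfolding lborel_prod by simp
  have "closed (UNIV \<times> {0..} :: ((real \<times> real) \<times> real) set)"
    by (intro closed_Times) auto
  then have "emeasure unit_intensity ?B = emeasure (lborel \<Otimes>\<^sub>M lborel) ?B"
    unfolding unit_intensity_def by (subst emeasure_restrict_space) (auto simp: lborel_prod)
  also have "\<dots> = (\<integral>\<^sup>+s. emeasure lborel (Pair s -` ?B) \<partial>lborel)"
    using B by (rule lborel.emeasure_pair_measure_alt)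
  also have "\<dots> = (\<integral>\<^sup>+s. ennreal (F s) \<partial>lborel)"
  proof (rule nn_integral_cong)
    fix s
    have "Pair s -` ?B = {0..<F s}" by auto
    then show "emeasure lborel (Pair s -` ?B) = ennreal (F s)"
      using F[of s] by simp
  qed
  finally show ?thesis .
qed

text \<open>A supremum is bounded by \<open>w\<close> iff every term is. Since \<open>\<phi>\<close>
  is strictly positive, a point at height 0 contributes \<infinity> on the left and violates the
  inequality on the right, so the equivalence survives there too.\<close>

lemma moving_max_le_iff:
  assumes "\<And>s. 0 < \<phi> s" and "\<And>j. 0 \<le> Y j \<omega>" and "0 < w"
  shows "moving_max \<phi> X W Y t \<omega> \<le> ereal w \<longleftrightarrow> (\<forall>j. \<phi> ((X j \<omega>, W j \<omega>) - t) / w \<le> Y j \<omega>)"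
proof -
  have "ereal a / ereal y \<le> ereal w \<longleftrightarrow> a / w \<le> y" if "0 < a" "0 \<le> y" for a y
  proof (cases "y = 0")
    case True
    then show ?thesis using that \<open>0 < w\<close> by (simp add: divide_ereal_def field_simps)
  next
    case False
    then show ?thesis using that \<open>0 < w\<close> by (simp add: field_simps)
  qed
  with assms show ?thesis
    by (cases t) (simp only: moving_max_def SUP_le_iff prod.case diff_Pair UNIV_I ball_UNIV)
qed

section \<open>The joint law at two sites in terms of the random vector\<close>

lemma distributed_measure:
  assumes "prob_space N" and "distributed N lborel T f" and "A \<in> sets borel"
  shows "ennreal (measure N {v \<in> space N. T v \<in> A}) = (\<integral>\<^sup>+s. f s * indicator A s \<partial>lborel)"
proof -
  interpret prob_space N by fact
  have "{v \<in> space N. T v \<in> A} = T -` A \<inter> space N" by auto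
  then show ?thesis
    using distributed_emeasure[OF assms(2), of A] assms(3) by (simp add: emeasure_eq_measure)
qed

text \<open>On \<open>D\<close> the maximum is its first term, off \<open>D\<close> its second.
  Substituting \<open>s + t\<close> for \<open>s\<close> in the second integral moves the shift from
  the density to the set. The inequalities are weak, so ties may be put on either side of
  \<open>D\<close>.\<close>

lemma nn_integral_max_shifted_density:
  fixes \<phi> :: "'a::euclidean_space \<Rightarrow> real" and T :: "'b \<Rightarrow> 'a"
  assumes N: "prob_space N" "distributed N lborel T (\<lambda>u. ennreal (\<phi> u))"
    and \<phi> [measurable]: "\<phi> \<in> borel_measurable borel" and pos: "\<And>s. 0 \<le> \<phi> s"
    and w: "0 < w1" "0 < w2"
    and D [measurable]: "D \<in> sets borel"
    and D1: "\<And>s. s \<in> D \<Longrightarrow> \<phi> (s - t) / w2 \<le> \<phi> s / w1"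
    and D2: "\<And>s. s \<notin> D \<Longrightarrow> \<phi> s / w1 \<le> \<phi> (s - t) / w2"
  shows "(\<integral>\<^sup>+s. ennreal (max (\<phi> s / w1) (\<phi> (s - t) / w2)) \<partial>lborel) =
    ennreal (1 / w1 * measure N {v \<in> space N. T v \<in> D} +
      1 / w2 * measure N {v \<in> space N. T v + t \<notin> D})"
proof -
  have "(\<integral>\<^sup>+s. ennreal (max (\<phi> s / w1) (\<phi> (s - t) / w2)) \<partial>lborel) =
    (\<integral>\<^sup>+s. ennreal (1 / w1) * (ennreal (\<phi> s) * indicator D s)
      + ennreal (1 / w2) * (ennreal (\<phi> (s - t)) * indicator (- D) s) \<partial>lborel)"
  proof (rule nn_integral_cong)
    fix s
    show "ennreal (max (\<phi> s / w1) (\<phi> (s - t) / w2)) =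
        ennreal (1 / w1) * (ennreal (\<phi> s) * indicator D s)
        + ennreal (1 / w2) * (ennreal (\<phi> (s - t)) * indicator (- D) s)"
      using D1[of s] D2[of s] pos w
      by (cases "s \<in> D") (simp_all add: ennreal_mult[symmetric] max_def)
  qed
  also have "\<dots> = ennreal (1 / w1) * (\<integral>\<^sup>+s. ennreal (\<phi> s) * indicator D s \<partial>lborel)
      + ennreal (1 / w2) * (\<integral>\<^sup>+s. ennreal (\<phi> (s - t)) * indicator (- D) s \<partial>lborel)"
    by (subst nn_integral_add) (simp_all add: nn_integral_cmult)
  also have "(\<integral>\<^sup>+s. ennreal (\<phi> (s - t)) * indicator (- D) s \<partial>lborel) =
      (\<integral>\<^sup>+s. ennreal (\<phi> s) * indicator {u. u + t \<notin> D} s \<partial>lborel)"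
    by (subst nn_integral_lborel_translate[of "\<lambda>s. ennreal (\<phi> (s - t)) * indicator (- D) s" t, symmetric])
       (auto intro!: nn_integral_cong split: split_indicator)
  also have "\<dots> = measure N {v \<in> space N. T v + t \<notin> D}"
  proof -
    have "{u. u + t \<notin> D} \<in> sets borel"
    proof -
      have "{u \<in> space borel. u + t \<notin> D} \<in> sets borel" by measurable
      then show ?thesis by simp
    qed
    from distributed_measure[OF N this] show ?thesis by simp
  qed
  also have "(\<integral>\<^sup>+s. ennreal (\<phi> s) * indicator D s \<partial>lborel) = measure N {v \<in> space N. T v \<in> D}"
    using distributed_measure[OF N D] by simp
  finally show ?thesis
    using w by (simp add: ennreal_mult[symmetric] ennreal_plus[symmetric] del: ennreal_plus)
qed

text \<open>Void probability of a hypograph, with its mass evaluated by splitting along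
  \<open>D\<close>. The set \<open>D\<close> stays free so that all cases of the theorem become
  instances.\<close>

lemma moving_max_joint_law:
  fixes \<phi> :: "real \<times> real \<Rightarrow> real" and T :: "'b \<Rightarrow> real \<times> real"
  assumes PP: "poisson_process M unit_intensity (\<lambda>j \<omega>. ((X j \<omega>, W j \<omega>), Y j \<omega>))"
    and N: "prob_space N" "distributed N lborel T (\<lambda>u. ennreal (\<phi> u))"
    and \<phi> [measurable]: "\<phi> \<in> borel_measurable borel" and pos: "\<And>s. 0 < \<phi> s"
    and w: "0 < w1" "0 < w2"
    and D: "D \<in> sets borel"
      "\<And>s. s \<in> D \<Longrightarrow> \<phi> (s - t) / w2 \<le> \<phi> s / w1"
      "\<And>s. s \<notin> D \<Longrightarrow> \<phi> s / w1 \<le> \<phi> (s - t) / w2"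
  shows "- ln (measure M {\<omega> \<in> space M. moving_max \<phi> X W Y (0, 0) \<omega> \<le> ereal w1 \<and>
      moving_max \<phi> X W Y t \<omega> \<le> ereal w2}) =
    1 / w1 * measure N {v \<in> space N. T v \<in> D} + 1 / w2 * measure N {v \<in> space N. T v + t \<notin> D}"
    (is "- ln (measure M ?E) = ?R")
proof -
  define F where "F = (\<lambda>s. max (\<phi> s / w1) (\<phi> (s - t) / w2))"
  \<comment> \<open>The bound \<open>y < F s\<close> is strict because a point exactly on the graph
    still respects both levels.\<close>
  define B where "B = {(s, y). 0 \<le> y \<and> y < F s}"
  have F: "F \<in> borel_measurable borel" "\<And>s. 0 \<le> F s"
    using w less_imp_le[OF pos] by (simp_all add: F_def le_max_iff_disj)
  have "?R \<ge> 0" using w by simp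
  have "emeasure unit_intensity B = ennreal ?R"
    unfolding B_def emeasure_unit_intensity_hypograph[OF F]
    unfolding F_def
    using nn_integral_max_shifted_density[where \<phi> = \<phi> and t = t, OF N \<phi> less_imp_le[OF pos] w D] by simp
  with \<open>?R \<ge> 0\<close> have B: "emeasure unit_intensity B < \<infinity>" "measure unit_intensity B = ?R"
    by (simp_all add: measure_def)
  have Y: "Y j \<omega> \<ge> 0" if "\<omega> \<in> space M" for j \<omega>
  proof -
    have "(\<lambda>\<omega>. ((X j \<omega>, W j \<omega>), Y j \<omega>)) \<in> measurable M unit_intensity"
      using PP by (simp add: poisson_process_def)
    from measurable_space[OF this that] show ?thesis
      by (simp add: unit_intensity_def space_restrict_space)
  qed
  have "moving_max \<phi> X W Y t \<omega> \<le> ereal w \<longleftrightarrow> (\<forall>j. \<phi> ((X j \<omega>, W j \<omega>) - t) / w \<le> Y j \<omega>)"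
    if "\<omega> \<in> space M" "0 < w" for \<omega> w t
    using moving_max_le_iff[where \<phi> = \<phi> and Y = Y and \<omega> = \<omega>, OF pos Y that(2)] that(1) by simp
  from this[of _ w1 "(0, 0)"] this[of _ w2 t]
  have "moving_max \<phi> X W Y (0, 0) \<omega> \<le> ereal w1 \<and> moving_max \<phi> X W Y t \<omega> \<le> ereal w2 \<longleftrightarrow>
      (\<forall>j. ((X j \<omega>, W j \<omega>), Y j \<omega>) \<notin> B)" if "\<omega> \<in> space M" for \<omega>
    using that w Y[OF that] by (auto simp: B_def F_def not_less zero_prod_def[symmetric])
  then have "?E = {\<omega> \<in> space M. \<forall>j. ((X j \<omega>, W j \<omega>), Y j \<omega>) \<notin> B}"
    by blast
  then show ?thesis
    using void_probability[OF PP sets_unit_intensity_hypograph[OF F(1), folded B_def] B(1)] B(2)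
    by simp
qed

section \<open>Projections of a rotation invariant random vector\<close>

text \<open>For a unit vector \<open>(a, b)\<close> the linear form is the first coordinate after a
  rotation, and a radial density does not change under that rotation.\<close>

lemma measure_rotation_invariant_linear:
  fixes T :: "'b \<Rightarrow> real \<times> real" and a b :: real
  assumes N: "prob_space N" "distributed N lborel T (\<lambda>u. ennreal (\<phi> u))"
    and \<phi> [measurable]: "\<phi> \<in> borel_measurable borel"
    and radial: "\<And>s s'. norm s = norm s' \<Longrightarrow> \<phi> s = \<phi> s'"
    and ab: "a\<^sup>2 + b\<^sup>2 = 1" and S [measurable]: "S \<in> sets borel"
  shows "measure N {v \<in> space N. a * fst (T v) + b * snd (T v) \<in> S} = measure N {v \<in> space N. fst (T v) \<in> S}"
proof -
  have meas: "{s. a * fst s + b * snd s \<in> S} \<in> sets borel" for a b :: real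
  proof -
    have "(\<lambda>s. a * fst s + b * snd s) \<in> borel_measurable (borel :: (real \<times> real) measure)"
      by (intro borel_measurable_continuous_onI continuous_intros)
    from measurable_sets[OF this S] show ?thesis by (simp add: vimage_def)
  qed
  have "ennreal (measure N {v \<in> space N. a * fst (T v) + b * snd (T v) \<in> S}) =
      (\<integral>\<^sup>+s. ennreal (\<phi> s) * indicator {s. a * fst s + b * snd s \<in> S} s \<partial>lborel)"
    using distributed_measure[OF N meas] by simp
  \<comment> \<open>The rotation has cosine \<open>a\<close> and sine \<open>- b\<close>, so its
    first coordinate is \<open>a * fst s + b * snd s\<close>. The integrand is left as an
    application to match the rotation lemma.\<close>
  also have "\<dots> = (\<integral>\<^sup>+s. (\<lambda>s. ennreal (\<phi> s) * indicator {s. fst s \<in> S} s)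
      (a * fst s - (- b) * snd s, (- b) * fst s + a * snd s) \<partial>lborel)"
  proof (rule nn_integral_cong)
    fix s :: "real \<times> real"
    have "(a * fst s - (- b) * snd s)\<^sup>2 + ((- b) * fst s + a * snd s)\<^sup>2
        = (a\<^sup>2 + b\<^sup>2) * ((fst s)\<^sup>2 + (snd s)\<^sup>2)"
      by algebra
    then have "norm (a * fst s - (- b) * snd s, (- b) * fst s + a * snd s) = norm s"
      using ab by (cases s) (simp add: norm_Pair)
    from radial[OF this]
    show "ennreal (\<phi> s) * indicator {s. a * fst s + b * snd s \<in> S} s =
      (\<lambda>s. ennreal (\<phi> s) * indicator {s. fst s \<in> S} s)
        (a * fst s - (- b) * snd s, (- b) * fst s + a * snd s)"
      by (simp split: split_indicator)
  qed
  also have "\<dots> = (\<integral>\<^sup>+s. ennreal (\<phi> s) * indicator {s. fst s \<in> S} s \<partial>lborel)"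
    using ab meas[of 1 0] by (intro nn_integral_lborel_rotate) simp_all
  also have "\<dots> = ennreal (measure N {v \<in> space N. fst (T v) \<in> S})"
    using distributed_measure[OF N meas[of 1 0]] by simp
  finally show ?thesis by simp
qed

text \<open>Vertical lines are Lebesgue null and \<open>T\<close> has a density. This allows strict
  and weak inequalities for the first coordinate to be exchanged.\<close>

lemma measure_fst_singleton_eq_0:
  fixes T :: "'b \<Rightarrow> real \<times> real"
  assumes "prob_space N" "distributed N lborel T f"
  shows "measure N {v \<in> space N. fst (T v) = r} = 0"
proof -
  have "closed ({r} \<times> UNIV :: (real \<times> real) set)"
    by (intro closed_Times) auto
  moreover have "emeasure (lborel \<Otimes>\<^sub>M lborel) ({r} \<times> UNIV :: (real \<times> real) set) = 0"
    by (subst lborel.emeasure_pair_measure_Times) simp_all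
  ultimately have "{r} \<times> UNIV \<in> null_sets (lborel :: (real \<times> real) measure)"
    by (simp add: lborel_prod null_sets_def)
  then have "(\<integral>\<^sup>+s. f s * indicator ({r} \<times> UNIV) s \<partial>lborel) = 0"
    by (rule nn_integral_null_set)
  moreover have "{v \<in> space N. T v \<in> {r} \<times> UNIV} = {v \<in> space N. fst (T v) = r}"
    by (auto simp: mem_Times_iff)
  ultimately show ?thesis
    using distributed_measure[OF assms, of "{r} \<times> UNIV"] \<open>closed _\<close> by simp
qed

section \<open>Comparison of the t-density with its shift, and the thresholds\<close>

lemma t_density_eq:
  "t_density \<beta> \<alpha> s = \<beta>\<^sup>2 / (2 * pi) * (1 + \<beta>\<^sup>2 / (2 * (\<alpha> - 1)) * (norm s)\<^sup>2) powr (- \<alpha>)"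
  by (cases s) (simp add: t_density_def norm_Pair)

lemma t_density_pos:
  assumes "0 < \<beta>" and "1 < \<alpha>"
  shows "0 < t_density \<beta> \<alpha> s"
proof -
  have "0 < 1 + \<beta>\<^sup>2 / (2 * (\<alpha> - 1)) * (norm s)\<^sup>2"
    using assms by (intro add_pos_nonneg mult_nonneg_nonneg divide_nonneg_pos) auto
  then show ?thesis using assms by (simp add: t_density_eq)
qed

lemma borel_measurable_t_density: "t_density \<beta> \<alpha> \<in> borel_measurable borel"
  unfolding t_density_eq[abs_def] by measurable

lemma powr_le_powr_iff:
  fixes a b c :: real
  assumes "0 \<le> a" "0 \<le> b" "0 < c"
  shows "a powr c \<le> b powr c \<longleftrightarrow> a \<le> b"
  using assms by (meson powr_mono2 powr_less_mono2 not_le less_imp_le)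

text \<open>After cancelling the normalising constant, both sides are powers with exponent \<alpha>,
  and \<open>x powr \<alpha> = w1 / w2\<close>; monotonicity of the power removes the exponent and
  leaves a comparison of quadratic polynomials. Both directions are kept since ties occur.\<close>

lemma t_density_ratio_le_iff:
  fixes \<beta> \<alpha> w1 w2 :: real
  assumes "0 < \<beta>" "1 < \<alpha>" "0 < w1" "0 < w2"
  defines "c \<equiv> \<beta>\<^sup>2 / (2 * (\<alpha> - 1))" and "x \<equiv> (w1 / w2) powr (1 / \<alpha>)"
  shows "t_density \<beta> \<alpha> p / w2 \<le> t_density \<beta> \<alpha> q / w1 \<longleftrightarrow>
      x * (1 + c * (norm q)\<^sup>2) \<le> 1 + c * (norm p)\<^sup>2" (is ?A)
    and "t_density \<beta> \<alpha> q / w1 \<le> t_density \<beta> \<alpha> p / w2 \<longleftrightarrow>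
      1 + c * (norm p)\<^sup>2 \<le> x * (1 + c * (norm q)\<^sup>2)" (is ?B)
proof -
  define P where "P = 1 + c * (norm p)\<^sup>2"
  define Q where "Q = 1 + c * (norm q)\<^sup>2"
  have "c > 0" using assms by (simp add: c_def)
  then have PQ: "P > 0" "Q > 0"
    by (auto simp: P_def Q_def intro!: add_pos_nonneg)
  have "x > 0" using assms by (simp add: x_def)
  have xa: "x powr \<alpha> = w1 / w2"
    using assms by (simp add: x_def powr_powr)
  have k: "\<beta>\<^sup>2 / (2 * pi) > 0" using assms by simp
  have dens: "t_density \<beta> \<alpha> p = \<beta>\<^sup>2 / (2 * pi) / P powr \<alpha>"
    "t_density \<beta> \<alpha> q = \<beta>\<^sup>2 / (2 * pi) / Q powr \<alpha>"
    by (simp_all add: t_density_eq P_def Q_def c_def powr_minus_divide)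
  have "(x * Q) powr \<alpha> = w1 / w2 * Q powr \<alpha>"
    using \<open>x > 0\<close> PQ by (simp add: powr_mult xa)
  moreover have "x * Q \<le> P \<longleftrightarrow> (x * Q) powr \<alpha> \<le> P powr \<alpha>" "P \<le> x * Q \<longleftrightarrow> P powr \<alpha> \<le> (x * Q) powr \<alpha>"
    using PQ \<open>x > 0\<close> assms by (simp_all add: powr_le_powr_iff)
  moreover have "K / p / w2 \<le> K / q / w1 \<longleftrightarrow> w1 / w2 * q \<le> p"
    "K / q / w1 \<le> K / p / w2 \<longleftrightarrow> p \<le> w1 / w2 * q" if "K > 0" "p > 0" "q > 0" for K p q :: real
    using that assms by (simp_all add: field_simps)
  note this[OF k, of "P powr \<alpha>" "Q powr \<alpha>"]
  ultimately show ?A ?B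
    using PQ unfolding dens P_def[symmetric] Q_def[symmetric] by simp_all
qed

text \<open>The thresholds are the roots of z^2 - (2 + c |t|^2) z + 1 with c = \<beta>^2 / (2
  (\<alpha> - 1)). Their product is 1, which places them on opposite sides of 1, and they meet there
  only for \<open>t = 0\<close>.\<close>

lemma b1_b2_properties:
  fixes \<beta> \<alpha> :: real
  assumes "0 < \<beta>" "1 < \<alpha>"
  shows "b1 \<beta> \<alpha> t + b2 \<beta> \<alpha> t = 2 + \<beta>\<^sup>2 / (2 * (\<alpha> - 1)) * (norm t)\<^sup>2"
    and "b1 \<beta> \<alpha> t * b2 \<beta> \<alpha> t = 1"
    and "0 < b1 \<beta> \<alpha> t" and "b1 \<beta> \<alpha> t \<le> 1" and "1 \<le> b2 \<beta> \<alpha> t"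
    and "b1 \<beta> \<alpha> t = 1 \<Longrightarrow> t = 0"
proof -
  define r where "r = \<beta> * norm t / sqrt (2 * (\<alpha> - 1))"
  define q where "q = sqrt (1 + r\<^sup>2 / 4)"
  have r2: "r\<^sup>2 = \<beta>\<^sup>2 / (2 * (\<alpha> - 1)) * (norm t)\<^sup>2"
    using assms by (simp add: r_def power_mult_distrib power_divide)
  have "r \<ge> 0" using assms by (simp add: r_def)
  have q2: "q\<^sup>2 = 1 + r\<^sup>2 / 4" by (simp add: q_def)
  have "\<beta>\<^sup>2 * (norm t)\<^sup>2 / (4 * (\<alpha> - 1)) = r\<^sup>2 / 2" "\<beta>\<^sup>2 * (norm t)\<^sup>2 / (8 * (\<alpha> - 1)) = r\<^sup>2 / 4"
    using assms by (simp_all add: r2 field_simps)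
  then have b: "b1 \<beta> \<alpha> t = 1 + r\<^sup>2 / 2 - r * q" "b2 \<beta> \<alpha> t = 1 + r\<^sup>2 / 2 + r * q"
    by (simp_all only: b1_def b2_def r_def[symmetric] q_def)
  then show "b1 \<beta> \<alpha> t + b2 \<beta> \<alpha> t = 2 + \<beta>\<^sup>2 / (2 * (\<alpha> - 1)) * (norm t)\<^sup>2"
    unfolding r2[symmetric] by simp
  have "b1 \<beta> \<alpha> t * b2 \<beta> \<alpha> t = (1 + r\<^sup>2 / 2)\<^sup>2 - r\<^sup>2 * q\<^sup>2"
    unfolding b by (simp add: algebra_simps power2_eq_square)
  also have "\<dots> = 1" unfolding q2 by (simp add: algebra_simps power2_eq_square)
  finally show prod: "b1 \<beta> \<alpha> t * b2 \<beta> \<alpha> t = 1" .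
  have "q \<ge> 0" by (simp add: q_def)
  then show "1 \<le> b2 \<beta> \<alpha> t" using \<open>r \<ge> 0\<close> by (simp add: b)
  with prod show "0 < b1 \<beta> \<alpha> t"
    by (metis less_le_trans zero_less_one zero_less_mult_pos2)
  \<comment> \<open>Makes the second factor in b1 = 1 - r (q - r/2) positive: hence b1 is at most 1,
    with equality only if \<open>r = 0\<close>.\<close>
  have "q > r / 2"
    using \<open>r \<ge> 0\<close> unfolding q_def by (intro real_less_rsqrt) (simp add: power_divide)
  have b1: "b1 \<beta> \<alpha> t = 1 - r * (q - r / 2)"
    by (simp add: b algebra_simps power2_eq_square)
  then show "b1 \<beta> \<alpha> t \<le> 1"
    using \<open>r \<ge> 0\<close> \<open>q > r / 2\<close> by simp
  assume "b1 \<beta> \<alpha> t = 1"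
  then have "r = 0" using b1 \<open>q > r / 2\<close> by simp
  then show "t = 0" using assms by (simp add: r_def)
qed

text \<open>Translates the case conditions on \<open>w2\<close> into conditions comparing
  \<open>x\<close> with a threshold \<open>b\<close>.\<close>

lemma powr_minus_mult_le_iff:
  fixes a b w1 w2 :: real
  assumes "0 < a" "0 < b" "0 < w1" "0 < w2"
  shows "b powr (- a) * w1 \<le> w2 \<longleftrightarrow> (w1 / w2) powr (1 / a) \<le> b"
proof -
  have "(w1 / w2) powr (1 / a) \<le> b \<longleftrightarrow> ((w1 / w2) powr (1 / a)) powr a \<le> b powr a"
    using assms by (simp add: powr_le_powr_iff)
  also have "\<dots> \<longleftrightarrow> w1 / w2 \<le> b powr a"
    using assms by (simp add: powr_powr)
  also have "\<dots> \<longleftrightarrow> b powr (- a) * w1 \<le> w2"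
    using assms by (simp add: powr_minus field_simps)
  finally show ?thesis by simp
qed

section \<open>The discs \<open>A1\<close> and \<open>A2\<close> as regions of dominance\<close>

lemma closed_A1: "closed (A1 \<beta> \<alpha> t x)"
proof -
  have "A1 \<beta> \<alpha> t x = {u. (fst u - fst t / (1 - x))\<^sup>2 + (snd u - snd t / (1 - x))\<^sup>2
       \<le> x * (norm t)\<^sup>2 / (1 - x)\<^sup>2 - 2 * (\<alpha> - 1) / \<beta>\<^sup>2}"
    by (auto simp: A1_def)
  then show ?thesis by (simp only:) (intro closed_Collect_le continuous_intros)
qed

text \<open>Both discs have the same radius, and t / (1 - x) - t = x t / (1 - x) relates the
  centres. So \<open>A2\<close> is what the shift in the joint law makes of
  \<open>A1\<close>.\<close>

lemma add_mem_A1_iff: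
  assumes "x \<noteq> 1"
  shows "u + t \<in> A1 \<beta> \<alpha> t x \<longleftrightarrow> u \<in> A2 \<beta> \<alpha> t x"
proof -
  have centre: "a + b - b / (1 - x) = a - b * x / (1 - x)" for a b :: real
    using assms by (simp add: field_simps)
  show ?thesis
    by (cases u; cases t)
      (simp only: A1_def A2_def add_Pair mem_Collect_eq prod.case fst_conv snd_conv centre)
qed

text \<open>The coefficient of |s|^2 on the left is (1 - x) c; factoring it out leaves the equation
  of the circle bounding \<open>A1\<close>. The sign of \<open>1 - x\<close> then decides between
  the disc and its complement.\<close>

lemma complete_square:
  fixes s t :: "real \<times> real" and c x :: real
  assumes "x \<noteq> 1" "c \<noteq> 0"
  shows "1 + c * (norm (s - t))\<^sup>2 - x * (1 + c * (norm s)\<^sup>2) = (1 - x) * c *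
    ((fst s - fst t / (1 - x))\<^sup>2 + (snd s - snd t / (1 - x))\<^sup>2 - (x * (norm t)\<^sup>2 / (1 - x)\<^sup>2 - 1 / c))"
proof -
  \<comment> \<open>With \<open>y\<close> for the reciprocal and the two facts on \<open>y\<close>
    and \<open>c\<close>, the identity becomes a polynomial consequence that \<open>algebra\<close>
    can check.\<close>
  define y where "y = 1 / (1 - x)"
  have y: "(1 - x) * y = 1" using assms by (simp add: y_def)
  have c: "c * (1 / c) = 1" using assms by simp
  obtain s1 s2 t1 t2 where st: "s = (s1, s2)" "t = (t1, t2)" by (cases s, cases t)
  have "x * (norm t)\<^sup>2 / (1 - x)\<^sup>2 = x * (norm t)\<^sup>2 * y\<^sup>2"
    by (simp add: y_def power_divide)
  moreover have "fst t / (1 - x) = t1 * y" "snd t / (1 - x) = t2 * y"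
    by (simp_all add: y_def st)
  moreover have "1 + c * ((s1 - t1)\<^sup>2 + (s2 - t2)\<^sup>2) - x * (1 + c * (s1\<^sup>2 + s2\<^sup>2)) = (1 - x) * c *
    ((s1 - t1 * y)\<^sup>2 + (s2 - t2 * y)\<^sup>2 - (x * (t1\<^sup>2 + t2\<^sup>2) * y\<^sup>2 - 1 / c))"
    using y c by algebra
  ultimately show ?thesis by (simp add: st norm_Pair)
qed

text \<open>All claims read off the sign of d = (1 - x) c (q - R), where \<open>R\<close> is the
  squared radius and \<open>q\<close> the squared distance to the centre. Above \<open>b2\<close>
  and below \<open>b1\<close> one has R \<le> 0 whenever x \<noteq> 1, so \<open>d\<close> has the
  same sign for every \<open>s\<close>.\<close>

lemma t_density_order_A1:
  fixes \<beta> \<alpha> w1 w2 :: real and s t :: "real \<times> real"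
  assumes "0 < \<beta>" "1 < \<alpha>" "0 < w1" "0 < w2"
  defines "x \<equiv> (w1 / w2) powr (1 / \<alpha>)"
  shows "x > 1 \<Longrightarrow> s \<in> A1 \<beta> \<alpha> t x \<Longrightarrow> t_density \<beta> \<alpha> (s - t) / w2 \<le> t_density \<beta> \<alpha> s / w1"
    and "x > 1 \<Longrightarrow> s \<notin> A1 \<beta> \<alpha> t x \<Longrightarrow> t_density \<beta> \<alpha> s / w1 \<le> t_density \<beta> \<alpha> (s - t) / w2"
    and "x < 1 \<Longrightarrow> s \<notin> A1 \<beta> \<alpha> t x \<Longrightarrow> t_density \<beta> \<alpha> (s - t) / w2 \<le> t_density \<beta> \<alpha> s / w1"
    and "x < 1 \<Longrightarrow> s \<in> A1 \<beta> \<alpha> t x \<Longrightarrow> t_density \<beta> \<alpha> s / w1 \<le> t_density \<beta> \<alpha> (s - t) / w2"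
    and "x > b2 \<beta> \<alpha> t \<Longrightarrow> t_density \<beta> \<alpha> s / w1 \<le> t_density \<beta> \<alpha> (s - t) / w2"
    and "x \<le> b1 \<beta> \<alpha> t \<Longrightarrow> t_density \<beta> \<alpha> (s - t) / w2 \<le> t_density \<beta> \<alpha> s / w1"
proof -
  define c where "c = \<beta>\<^sup>2 / (2 * (\<alpha> - 1))"
  have "c > 0" using assms by (simp add: c_def)
  define R where "R = x * (norm t)\<^sup>2 / (1 - x)\<^sup>2 - 1 / c"
  define q where "q = (fst s - fst t / (1 - x))\<^sup>2 + (snd s - snd t / (1 - x))\<^sup>2"
  have A1: "s \<in> A1 \<beta> \<alpha> t x \<longleftrightarrow> q - R \<le> 0"
    by (cases s) (simp add: A1_def q_def R_def c_def)
  define d where "d = 1 + c * (norm (s - t))\<^sup>2 - x * (1 + c * (norm s)\<^sup>2)"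
  have d: "d = (1 - x) * c * (q - R)" if "x \<noteq> 1"
    using complete_square[OF that, of c s t] \<open>c > 0\<close> by (simp add: d_def q_def R_def)
  have le: "t_density \<beta> \<alpha> (s - t) / w2 \<le> t_density \<beta> \<alpha> s / w1 \<longleftrightarrow> 0 \<le> d"
    "t_density \<beta> \<alpha> s / w1 \<le> t_density \<beta> \<alpha> (s - t) / w2 \<longleftrightarrow> d \<le> 0"
    using t_density_ratio_le_iff[where p = "s - t" and q = s, OF assms(1-4)]
    by (simp_all add: d_def c_def x_def)
  show "t_density \<beta> \<alpha> (s - t) / w2 \<le> t_density \<beta> \<alpha> s / w1" if "x > 1" "s \<in> A1 \<beta> \<alpha> t x"
    using that \<open>c > 0\<close> unfolding le A1 by (simp add: d zero_le_mult_iff mult_le_0_iff)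
  show "t_density \<beta> \<alpha> s / w1 \<le> t_density \<beta> \<alpha> (s - t) / w2" if "x > 1" "s \<notin> A1 \<beta> \<alpha> t x"
    using that \<open>c > 0\<close> unfolding le A1 by (simp add: d zero_le_mult_iff mult_le_0_iff)
  show "t_density \<beta> \<alpha> (s - t) / w2 \<le> t_density \<beta> \<alpha> s / w1" if "x < 1" "s \<notin> A1 \<beta> \<alpha> t x"
    using that \<open>c > 0\<close> unfolding le A1 by (simp add: d zero_le_mult_iff mult_le_0_iff)
  show "t_density \<beta> \<alpha> s / w1 \<le> t_density \<beta> \<alpha> (s - t) / w2" if "x < 1" "s \<in> A1 \<beta> \<alpha> t x"
    using that \<open>c > 0\<close> unfolding le A1 by (simp add: d zero_le_mult_iff mult_le_0_iff)
  note b = b1_b2_properties[OF assms(1,2), of t, folded c_def]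
  \<comment> \<open>The quadratic with roots \<open>b1\<close> and \<open>b2\<close>, evaluated at
    \<open>x\<close>, is - c (1 - x)^2 R; it is nonnegative outside the interval between the
    roots.\<close>
  have R: "R \<le> 0" if "x \<noteq> 1" "0 \<le> (x - b1 \<beta> \<alpha> t) * (x - b2 \<beta> \<alpha> t)"
  proof -
    have "(x - b1 \<beta> \<alpha> t) * (x - b2 \<beta> \<alpha> t)
        = x\<^sup>2 - (b1 \<beta> \<alpha> t + b2 \<beta> \<alpha> t) * x + b1 \<beta> \<alpha> t * b2 \<beta> \<alpha> t"
      by (simp add: algebra_simps power2_eq_square)
    also have "\<dots> = (1 - x)\<^sup>2 - c * (x * (norm t)\<^sup>2)"
      unfolding b(1,2) by (simp add: algebra_simps power2_eq_square)
    finally have "c * (x * (norm t)\<^sup>2) \<le> (1 - x)\<^sup>2" using that by simp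
    then show ?thesis
      using \<open>c > 0\<close> \<open>x \<noteq> 1\<close> by (simp add: R_def field_simps)
  qed
  have "0 \<le> q" by (simp add: q_def)
  show "t_density \<beta> \<alpha> s / w1 \<le> t_density \<beta> \<alpha> (s - t) / w2" if "x > b2 \<beta> \<alpha> t"
  proof -
    have "x > 1" using that b by linarith
    moreover have "0 \<le> (x - b1 \<beta> \<alpha> t) * (x - b2 \<beta> \<alpha> t)"
      using that b by (intro mult_nonneg_nonneg) linarith+
    ultimately show ?thesis
      using R \<open>0 \<le> q\<close> \<open>c > 0\<close> unfolding le by (simp add: d mult_le_0_iff)
  qed
  show "t_density \<beta> \<alpha> (s - t) / w2 \<le> t_density \<beta> \<alpha> s / w1" if "x \<le> b1 \<beta> \<alpha> t"
  \<comment> \<open>The value \<open>x = 1\<close> forces \<open>b1\<close> to be 1, hence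
    \<open>t = 0\<close>, and the two densities coincide.\<close>
  proof (cases "x = 1")
    case True
    then have "t = 0" using that b by simp
    then show ?thesis using True unfolding le by (simp add: d_def)
  next
    case False
    then have "x < 1" using that b by linarith
    moreover have "0 \<le> (x - b1 \<beta> \<alpha> t) * (x - b2 \<beta> \<alpha> t)"
      using that b by (intro mult_nonpos_nonpos) linarith+
    ultimately show ?thesis
      using R \<open>0 \<le> q\<close> \<open>c > 0\<close> unfolding le by (simp add: d)
  qed
qed

section \<open>Equal levels: half-planes bounded by a perpendicular bisector\<close>

lemma t_density_order_halfplane:
  fixes \<beta> \<alpha> w :: real and s t :: "real \<times> real"
  assumes "0 < \<beta>" "1 < \<alpha>" "0 < w"
  shows "t_density \<beta> \<alpha> (s - t) / w \<le> t_density \<beta> \<alpha> s / w \<longleftrightarrow> 2 * (s \<bullet> t) \<le> (norm t)\<^sup>2"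
    and "t_density \<beta> \<alpha> s / w \<le> t_density \<beta> \<alpha> (s - t) / w \<longleftrightarrow> (norm t)\<^sup>2 \<le> 2 * (s \<bullet> t)"
proof -
  define c where "c = \<beta>\<^sup>2 / (2 * (\<alpha> - 1))"
  have "c > 0" using assms by (simp add: c_def)
  \<comment> \<open>At \<open>x = 1\<close> the terms in |s|^2 cancel, so the boundary is the line
    of points equidistant from 0 and \<open>t\<close>.\<close>
  have n: "(norm (s - t))\<^sup>2 = (norm s)\<^sup>2 - 2 * (s \<bullet> t) + (norm t)\<^sup>2"
    by (simp add: power2_norm_eq_inner inner_diff inner_commute)
  have d: "1 + c * (norm (s - t))\<^sup>2 = 1 + c * (norm s)\<^sup>2 + c * ((norm t)\<^sup>2 - 2 * (s \<bullet> t))"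
    unfolding n by (simp add: algebra_simps)
  have "(w / w) powr (1 / \<alpha>) = 1" using assms by simp
  note le = t_density_ratio_le_iff[where p = "s - t" and q = s, OF assms(1-3) assms(3), folded c_def,
      unfolded this mult_1 d]
  show "t_density \<beta> \<alpha> (s - t) / w \<le> t_density \<beta> \<alpha> s / w \<longleftrightarrow> 2 * (s \<bullet> t) \<le> (norm t)\<^sup>2"
    and "t_density \<beta> \<alpha> s / w \<le> t_density \<beta> \<alpha> (s - t) / w \<longleftrightarrow> (norm t)\<^sup>2 \<le> 2 * (s \<bullet> t)"
    unfolding le using \<open>c > 0\<close> by (simp_all add: zero_le_mult_iff mult_le_0_iff)
qed

text \<open>With e = t / |t|, the first event bounds the projection of \<open>T\<close> on e by
  |t|/2, and the second bounds its projection on -e strictly by |t|/2. Both projections are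
  distributed like the first coordinate, for which strictness is immaterial.\<close>

lemma radial_measure_halfplanes:
  fixes T :: "'b \<Rightarrow> real \<times> real" and t :: "real \<times> real"
  assumes N: "prob_space N" "distributed N lborel T (\<lambda>u. ennreal (\<phi> u))"
    and \<phi>: "\<phi> \<in> borel_measurable borel"
    and radial: "\<And>s s'. norm s = norm s' \<Longrightarrow> \<phi> s = \<phi> s'"
  shows "measure N {v \<in> space N. 2 * (T v \<bullet> t) \<le> (norm t)\<^sup>2}
      + measure N {v \<in> space N. \<not> 2 * ((T v + t) \<bullet> t) \<le> (norm t)\<^sup>2}
    = 2 * measure N {v \<in> space N. fst (T v) \<le> norm t / 2}"
proof -
  interpret prob_space N by fact
  have T: "T \<in> borel_measurable N"
    using distributed_measurable[OF N(2)] by simp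
  have fstT [measurable]: "(\<lambda>v. fst (T v)) \<in> borel_measurable N"
    by (intro borel_measurable_continuous_on[OF _ T] continuous_intros)
  define r where "r = norm t"
  have strict: "measure N {v \<in> space N. fst (T v) < r / 2} = measure N {v \<in> space N. fst (T v) \<le> r / 2}"
  proof -
    have "measure N {v \<in> space N. fst (T v) \<le> r / 2} =
        measure N ({v \<in> space N. fst (T v) < r / 2} \<union> {v \<in> space N. fst (T v) = r / 2})"
      by (rule arg_cong[where f = "measure N"]) auto
    also have "\<dots> = measure N {v \<in> space N. fst (T v) < r / 2} + measure N {v \<in> space N. fst (T v) = r / 2}"
      by (rule finite_measure_Union) auto
    finally show ?thesis using measure_fst_singleton_eq_0[OF N, of "r / 2"] by simp
  qed
  show ?thesis
  proof (cases "t = 0")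
    case True
    \<comment> \<open>There is no direction t / |t| here. The two events are the whole space and the
      empty set, so the claim is that the first coordinate is at most 0 with probability 1/2; this
      follows from symmetry under the half turn and the null line.\<close>
    have "measure N {v \<in> space N. (- 1) * fst (T v) + 0 * snd (T v) \<in> {..<0}}
        = measure N {v \<in> space N. fst (T v) \<in> {..<0}}"
      by (rule measure_rotation_invariant_linear[OF N \<phi> radial]) auto
    moreover have "{v \<in> space N. fst (T v) < 0} \<union> {v \<in> space N. fst (T v) > 0}
        \<union> {v \<in> space N. fst (T v) = 0} = space N"
      by auto
    moreover have "measure N ({v \<in> space N. fst (T v) < 0} \<union> {v \<in> space N. fst (T v) > 0}
        \<union> {v \<in> space N. fst (T v) = 0}) = measure N {v \<in> space N. fst (T v) < 0}
        + measure N {v \<in> space N. fst (T v) > 0} + measure N {v \<in> space N. fst (T v) = 0}"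
      by (subst finite_measure_Union; (subst finite_measure_Union)?) auto
    ultimately show ?thesis
      using True strict measure_fst_singleton_eq_0[OF N, of 0] by (simp add: r_def prob_space)
  next
    case False
    then have "r > 0" by (simp add: r_def)
    obtain t1 t2 where t: "t = (t1, t2)" by (cases t)
    have r2: "r\<^sup>2 = t1\<^sup>2 + t2\<^sup>2" by (simp add: r_def t norm_Pair)
    have "(t1 / r)\<^sup>2 + (t2 / r)\<^sup>2 = r\<^sup>2 / r\<^sup>2"
      by (simp only: r2 power_divide add_divide_distrib)
    then have unit: "(t1 / r)\<^sup>2 + (t2 / r)\<^sup>2 = 1"
      using \<open>r > 0\<close> by simp
    \<comment> \<open>\<open>l\<close> is the signed length of the projection on the direction of
      \<open>t\<close>.\<close>
    define l where "l = (\<lambda>u. t1 / r * fst u + t2 / r * snd u)"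
    have inner: "u \<bullet> t = r * l u" for u
      using \<open>r > 0\<close> by (cases u) (simp add: t l_def algebra_simps)
    have "2 * (u \<bullet> t) \<le> (norm t)\<^sup>2 \<longleftrightarrow> l u \<in> {..r / 2}" for u
    proof -
      have "2 * (u \<bullet> t) \<le> (norm t)\<^sup>2 \<longleftrightarrow> r * (2 * l u) \<le> r * r"
        unfolding inner r_def[symmetric] by (simp add: power2_eq_square mult.left_commute)
      also have "\<dots> \<longleftrightarrow> 2 * l u \<le> r"
        using \<open>r > 0\<close> by (rule mult_le_cancel_left_pos)
      finally show ?thesis by auto
    qed
    then have 1: "measure N {v \<in> space N. 2 * (T v \<bullet> t) \<le> (norm t)\<^sup>2}
        = measure N {v \<in> space N. fst (T v) \<le> r / 2}"
      using measure_rotation_invariant_linear[OF N \<phi> radial unit, of "{..r / 2}"]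
      by (simp add: l_def)
    have "\<not> 2 * ((u + t) \<bullet> t) \<le> (norm t)\<^sup>2 \<longleftrightarrow> - l u \<in> {..<r / 2}" for u
    proof -
      have "\<not> 2 * ((u + t) \<bullet> t) \<le> (norm t)\<^sup>2 \<longleftrightarrow> r * (- (2 * l u)) < r * r"
        unfolding inner_add_left power2_norm_eq_inner[of t, symmetric] inner[of u] r_def[symmetric]
        by (auto simp: power2_eq_square not_le algebra_simps)
      also have "\<dots> \<longleftrightarrow> - (2 * l u) < r"
        using \<open>r > 0\<close> by (rule mult_less_cancel_left_pos)
      finally show ?thesis by auto
    qed
    moreover have "- l u = - (t1 / r) * fst u + - (t2 / r) * snd u" for u
      by (simp add: l_def)
    ultimately have 2: "measure N {v \<in> space N. \<not> 2 * ((T v + t) \<bullet> t) \<le> (norm t)\<^sup>2}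
        = measure N {v \<in> space N. fst (T v) < r / 2}"
      using measure_rotation_invariant_linear[OF N \<phi> radial, of "- (t1 / r)" "- (t2 / r)" "{..<r / 2}"] unit
      by simp
    show ?thesis using 1 2 strict by (simp add: r_def)
  qed
qed

section \<open>Assembly of the five cases\<close>

theorem proposition2p6:
  fixes M :: "'a measure" and X W Y :: "nat \<Rightarrow> 'a \<Rightarrow> real"
    and N :: "'b measure" and T1 T2 :: "'b \<Rightarrow> real"
    and \<alpha> \<beta> t1 t2 w1 w2 :: real
  assumes "\<beta> > 0" and "\<alpha> > 1" and "w1 > 0" and "w2 > 0"
    and "poisson_process M unit_intensity (\<lambda>j \<omega>. ((X j \<omega>, W j \<omega>), Y j \<omega>))"
    and "prob_space N"
    and "distributed N lborel (\<lambda>v. (T1 v, T2 v)) (\<lambda>u. ennreal (t_density \<beta> \<alpha> u))"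
  shows "let t = (t1, t2);
             Z = moving_max (t_density \<beta> \<alpha>) X W Y;
             L = - ln (measure M {\<omega> \<in> space M. Z (0, 0) \<omega> \<le> ereal w1 \<and> Z (t1, t2) \<omega> \<le> ereal w2});
             PT = (\<lambda>A. measure N {v \<in> space N. (T1 v, T2 v) \<in> A});
             x = (w1 / w2) powr (1 / \<alpha>)
         in (w2 < b2 \<beta> \<alpha> t powr (- \<alpha>) * w1 \<longrightarrow> L = 1 / w2) \<and>
            (b2 \<beta> \<alpha> t powr (- \<alpha>) * w1 \<le> w2 \<and> w2 < w1 \<longrightarrow>
               L = 1 / w1 * PT (A1 \<beta> \<alpha> t x) + 1 / w2 * PT (- A2 \<beta> \<alpha> t x)) \<and>
            (w1 = w2 \<longrightarrow>
               L = 2 / w1 * measure N {v \<in> space N. T1 v \<le> norm t / 2}) \<and>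
            (w1 < w2 \<and> w2 < b1 \<beta> \<alpha> t powr (- \<alpha>) * w1 \<longrightarrow>
               L = 1 / w1 * PT (- A1 \<beta> \<alpha> t x) + 1 / w2 * PT (A2 \<beta> \<alpha> t x)) \<and>
            (b1 \<beta> \<alpha> t powr (- \<alpha>) * w1 \<le> w2 \<longrightarrow> L = 1 / w1)"
proof -
  define t where "t = (t1, t2)"
  define x where "x = (w1 / w2) powr (1 / \<alpha>)"
  define Z where "Z = moving_max (t_density \<beta> \<alpha>) X W Y"
  define L where "L = - ln (measure M {\<omega> \<in> space M. Z (0, 0) \<omega> \<le> ereal w1 \<and> Z t \<omega> \<le> ereal w2})"
  define PT where "PT = (\<lambda>A. measure N {v \<in> space N. (T1 v, T2 v) \<in> A})"
  note pos = assms(1-4)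
  note N = assms(6,7)
  interpret N: prob_space N by fact
  \<comment> \<open>Each case is one choice of \<open>D\<close>: the empty set, \<open>A1\<close>, a
    half-plane, the complement of \<open>A1\<close>, or the whole plane.\<close>
  have law: "L = 1 / w1 * PT D + 1 / w2 * PT {u. u + t \<notin> D}"
    if "D \<in> sets borel"
      "\<And>s. s \<in> D \<Longrightarrow> t_density \<beta> \<alpha> (s - t) / w2 \<le> t_density \<beta> \<alpha> s / w1"
      "\<And>s. s \<notin> D \<Longrightarrow> t_density \<beta> \<alpha> s / w1 \<le> t_density \<beta> \<alpha> (s - t) / w2" for D
    unfolding L_def Z_def PT_def mem_Collect_eq
    by (rule moving_max_joint_law[where \<phi> = "t_density \<beta> \<alpha>" and T = "\<lambda>v. (T1 v, T2 v)" and t = t and D = D,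
          OF assms(5) N borel_measurable_t_density t_density_pos[OF pos(1,2)] pos(3,4) that])
  have PT_UNIV: "PT UNIV = 1" and PT_empty: "PT {} = 0"
    by (simp_all add: PT_def N.prob_space)
  note order = t_density_order_A1[OF pos, folded x_def, where t = t]
  note b = b1_b2_properties[OF pos(1,2), of t]
  \<comment> \<open>The order of \<open>w1\<close> and \<open>w2\<close> fixes the side of 1 on
    which \<open>x\<close> lies, and so whether the first term dominates inside or outside the
    disc.\<close>
  have x_less: "x < 1 \<longleftrightarrow> w1 < w2" and x_gr: "1 < x \<longleftrightarrow> w2 < w1"
    using powr_minus_mult_le_iff[of \<alpha> 1 w1 w2] powr_le_powr_iff[of 1 "w1 / w2" "1 / \<alpha>"] pos
    by (auto simp: x_def not_le[symmetric])
  have xb: "b powr (- \<alpha>) * w1 \<le> w2 \<longleftrightarrow> x \<le> b" if "b > 0" for b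
    unfolding x_def using pos that by (intro powr_minus_mult_le_iff) auto
  have A2: "{u. u + t \<notin> A1 \<beta> \<alpha> t x} = - A2 \<beta> \<alpha> t x" "{u. u + t \<notin> - A1 \<beta> \<alpha> t x} = A2 \<beta> \<alpha> t x"
    if "x \<noteq> 1"
    using add_mem_A1_iff[OF that] by auto
  have "L = 1 / w2" if "w2 < b2 \<beta> \<alpha> t powr (- \<alpha>) * w1"
  proof -
    have "x > b2 \<beta> \<alpha> t" using that xb[of "b2 \<beta> \<alpha> t"] b by linarith
    then show ?thesis using law[of "{}"] order by (simp add: PT_UNIV PT_empty)
  qed
  moreover have "L = 1 / w1 * PT (A1 \<beta> \<alpha> t x) + 1 / w2 * PT (- A2 \<beta> \<alpha> t x)" if "w2 < w1"
    using law[of "A1 \<beta> \<alpha> t x"] order that closed_A1 A2 x_gr by auto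
  moreover have "L = 2 / w1 * measure N {v \<in> space N. T1 v \<le> norm t / 2}" if "w1 = w2"
  proof -
    let ?D = "{s. 2 * (s \<bullet> t) \<le> (norm t)\<^sup>2}"
    have "closed ?D" by (intro closed_Collect_le continuous_intros)
    then have "L = 1 / w1 * PT ?D + 1 / w2 * PT {u. u + t \<notin> ?D}"
      using t_density_order_halfplane[OF pos(1-3), of _ t] that by (intro law) auto
    also have "\<dots> = 1 / w1 * (PT ?D + PT {u. u + t \<notin> ?D})"
      using that by (simp add: algebra_simps)
    \<comment> \<open>The t-density depends on its argument only through the norm, so the radial
      half-plane identity applies.\<close>
    also have "PT ?D + PT {u. u + t \<notin> ?D} = 2 * measure N {v \<in> space N. T1 v \<le> norm t / 2}"
      using radial_measure_halfplanes[OF N borel_measurable_t_density, of t]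
      by (simp add: PT_def t_density_eq)
    finally show ?thesis by simp
  qed
  moreover have "L = 1 / w1 * PT (- A1 \<beta> \<alpha> t x) + 1 / w2 * PT (A2 \<beta> \<alpha> t x)" if "w1 < w2"
    using law[of "- A1 \<beta> \<alpha> t x"] order that closed_A1 A2 x_less by auto
  moreover have "L = 1 / w1" if "b1 \<beta> \<alpha> t powr (- \<alpha>) * w1 \<le> w2"
    using law[of UNIV] order that xb[of "b1 \<beta> \<alpha> t"] b by (simp add: PT_UNIV PT_empty)
  ultimately show ?thesis
    unfolding Let_def t_def[symmetric] Z_def[symmetric] x_def[symmetric] L_def[symmetric]
      PT_def[symmetric]
    by blast
qed

end
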